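(* The group $G(F)$ generated by the elementary operations $*,-,r_1,r_2,R$ on $PM_{2\times2}(\mathbb Z)$ has the group presentation $$\langle\, x,y,z \mid x^2=y^2=z^2=1,\ xyxy=yxyx,\ xz=zx,\ yz=zy\,\rangle.$$ Furthermore, $G(F)$ is isomorphic to the Coxeter group $C_M$ with the Coxeter matrix $$M=\begin{pmatrix}1&4&2\\4&1&2\\2&2&1\end{pmatrix}.$$ That is, $G(F)=\langle\, x,y,z\mid x^2=y^2=z^2=(xy)^4=(yx)^4=(xz)^2=(zx)^2=(yz)^2=(zy)^2=1\,\rangle$.
   Context: $PM_{2\times2}(\mathbb Z)$ is the set of $2\times2$ integer matrices modulo multiplication by $\pm1$; square brackets denote the class of a matrix. The five elementary operations are the functions $PM_{2\times2}(\mathbb Z)\to PM_{2\times2}(\mathbb Z)$ given, for $X=\left[\begin{matrix}\alpha&\gamma\\\beta&\delta\end{matrix}\right]$, by $$X^*=\left[\begin{matrix}\alpha&-\gamma\\-\beta&\delta\end{matrix}\right],\quad X^-=\left[\begin{matrix}\delta&\gamma\\\beta&\alpha\end{matrix}\right],\quad X^{r_1}=\left[\begin{matrix}-\gamma&\alpha\\-\delta&\beta\end{matrix}\right],\quad X^{r_2}=\left[\begin{matrix}-\beta&-\delta\\\alpha&\gamma\end{matrix}\right],\quad X^R=\left[\begin{matrix}\delta&-\beta\\-\gamma&\alpha\end{matrix}\right].$$ (They are induced, via a tangle invariant with values in $PM_{2\times2}(\mathbb Z)$, by the operations on diagrams of 1-punctured ball tangles: mirror image, interchange of the inside and outside holes,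 $90^\circ$ counterclockwise rotation of the inside hole only, of the outside hole only, and of the whole diagram, respectively.) $G(F)$ is the group of bijections of $PM_{2\times2}(\mathbb Z)$ generated by these five functions; the binary operation is the opposite composition of functions, i.e. the product $fg$ means "first $f$, then $g$". An $n\times n$ matrix $M$ is a Coxeter matrix if $M_{ii}=1$ and $M_{ij}=M_{ji}>1$ for all $i\ne j$; the Coxeter group $C_M$ is the group presented by $\langle x_1,\dots,x_n\mid (x_ix_j)^{M_{ij}}=1 \text{ for all } i,j\in\{1,\dots,n\}\rangle$. *)

theory Defs
  imports "HOL-Analysis.Cartesian_Space" "HOL-Algebra.Generated_Groups"
begin

definition mat2 :: "int \<Rightarrow> int \<Rightarrow> int \<Rightarrow> int \<Rightarrow> int^2^2"
  where "mat2 a b c d = vector [vector [a, b], vector [c, d]]"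

lemma mat2_entries [simp]:
  "mat2 a b c d $ 1 $ 1 = a" "mat2 a b c d $ 1 $ 2 = b"
  "mat2 a b c d $ 2 $ 1 = c" "mat2 a b c d $ 2 $ 2 = d"
  by (simp_all add: mat2_def)

lemma mat2_eq_iff: "A = B \<longleftrightarrow> A $ 1 $ 1 = B $ 1 $ 1 \<and> A $ 1 $ 2 = B $ 1 $ 2
    \<and> A $ 2 $ 1 = B $ 2 $ 1 \<and> A $ 2 $ 2 = B $ 2 $ 2"
  for A B :: "int^2^2"
  by (auto simp: vec_eq_iff forall_2)

quotient_type pm22 = "int^2^2" / "\<lambda>A B. A = B \<or> A = - B"
  by (rule equivpI) (auto simp: reflp_def symp_def transp_def)

text \<open>
  The matrix with rows \<open>(\<alpha>, \<gamma>)\<close> and \<open>(\<beta>, \<delta>)\<close> is \<open>mat2 \<alpha> \<gamma> \<beta> \<delta>\<close>, so that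
  \<open>\<alpha> = X $ 1 $ 1\<close>, \<open>\<gamma> = X $ 1 $ 2\<close>, \<open>\<beta> = X $ 2 $ 1\<close>, \<open>\<delta> = X $ 2 $ 2\<close>.
\<close>

lift_definition op_star :: "pm22 \<Rightarrow> pm22"
  is "\<lambda>X. mat2 (X $ 1 $ 1) (- X $ 1 $ 2) (- X $ 2 $ 1) (X $ 2 $ 2)"
  by (auto simp: mat2_eq_iff)

lift_definition op_minus :: "pm22 \<Rightarrow> pm22"
  is "\<lambda>X. mat2 (X $ 2 $ 2) (X $ 1 $ 2) (X $ 2 $ 1) (X $ 1 $ 1)"
  by (auto simp: mat2_eq_iff)

lift_definition op_r1 :: "pm22 \<Rightarrow> pm22"
  is "\<lambda>X. mat2 (- X $ 1 $ 2) (X $ 1 $ 1) (- X $ 2 $ 2) (X $ 2 $ 1)"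
  by (auto simp: mat2_eq_iff)

lift_definition op_r2 :: "pm22 \<Rightarrow> pm22"
  is "\<lambda>X. mat2 (- X $ 2 $ 1) (- X $ 2 $ 2) (X $ 1 $ 1) (X $ 1 $ 2)"
  by (auto simp: mat2_eq_iff)

lift_definition op_R :: "pm22 \<Rightarrow> pm22"
  is "\<lambda>X. mat2 (X $ 2 $ 2) (- X $ 2 $ 1) (- X $ 1 $ 2) (X $ 1 $ 1)"
  by (auto simp: mat2_eq_iff)

definition bij_op_group :: "('a \<Rightarrow> 'a) monoid"
  where "bij_op_group = \<lparr>carrier = {f. bij f}, monoid.mult = (\<lambda>f g. g \<circ> f), one = id\<rparr>"

lemma elementary_operations_bij:
  "{op_star, op_minus, op_r1, op_r2, op_R} \<subseteq> carrier bij_op_group"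
proof -
  have inv: "op_star (op_star X) = X" "op_minus (op_minus X) = X" "op_R (op_R X) = X"
    "op_r1 (op_r1 X) = X" "op_r2 (op_r2 X) = X" for X
    by (transfer; simp add: mat2_eq_iff)+
  show ?thesis
    by (simp add: bij_op_group_def involuntory_imp_bij inv)
qed

definition GF :: "(pm22 \<Rightarrow> pm22) monoid"
  where "GF = bij_op_group
    \<lparr>carrier := generate bij_op_group {op_star, op_minus, op_r1, op_r2, op_R}\<rparr>"

text \<open>
  The free group on the elements of a type, realised on reduced words; the letter
  \<open>(a, True)\<close> stands for the generator \<open>a\<close> and \<open>(a, False)\<close> for its inverse.
\<close>

type_synonym 'a word = "('a \<times> bool) list"

fun reduced_Cons :: "'a \<times> bool \<Rightarrow> 'a word \<Rightarrow> 'a word" where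
  "reduced_Cons p [] = [p]"
| "reduced_Cons p (q # w) = (if fst p = fst q \<and> snd p \<noteq> snd q then w else p # q # w)"

definition reduce :: "'a word \<Rightarrow> 'a word"
  where "reduce w = foldr reduced_Cons w []"

definition free_group :: "'a word monoid"
  where "free_group = \<lparr>carrier = range reduce, monoid.mult = (\<lambda>u v. reduce (u @ v)), one = []\<rparr>"

definition free_gen :: "'a \<Rightarrow> 'a word"
  where "free_gen a = [(a, True)]"

definition normal_closure :: "('g, 'b) monoid_scheme \<Rightarrow> 'g set \<Rightarrow> 'g set"
  where "normal_closure G R = \<Inter> {N. N \<lhd> G \<and> R \<subseteq> N}"

text \<open>A pair \<open>(u, v)\<close> in the set of relations stands for the relation \<open>u = v\<close>.\<close>

definition presented_group :: "('a word \<times> 'a word) set \<Rightarrow> 'a word set monoid"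
  where "presented_group rels = free_group Mod
    normal_closure free_group {u \<otimes>\<^bsub>free_group\<^esub> inv\<^bsub>free_group\<^esub> v | u v. (u, v) \<in> rels}"

text \<open>
  Square matrices are indexed by a finite type; for \<open>3\<times>3\<close> matrices the index type is \<open>3\<close>,
  whose elements are \<open>1\<close>, \<open>2\<close> and \<open>3 = 0\<close>.
\<close>

definition coxeter_matrix :: "nat^'n^'n \<Rightarrow> bool"
  where "coxeter_matrix M \<longleftrightarrow>
    (\<forall>i. M $ i $ i = 1) \<and> (\<forall>i j. i \<noteq> j \<longrightarrow> M $ i $ j = M $ j $ i \<and> M $ i $ j > 1)"

definition coxeter_group :: "nat^'n^'n \<Rightarrow> 'n word set monoid"
  where "coxeter_group M = presented_group
    {((free_gen i \<otimes>\<^bsub>free_group\<^esub> free_gen j) [^]\<^bsub>free_group\<^esub> (M $ i $ j), \<one>\<^bsub>free_group\<^esub>) | i j. True}"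

end

theory Submission
  imports Defs
begin

text \<open>
  Modulo sign, \<open>r\<^sub>1\<close> and \<open>r\<^sub>2\<close> multiply a matrix by a quarter turn from the right and from the
  left. Conjugation by \<open>-\<close> exchanges the two, and \<open>R\<close> is their product, so \<open>x = -\<close>, \<open>y = r\<^sub>1\<close> and
  \<open>z = *\<close> generate the group. The first two are noncommuting involutions that satisfy
  \<open>xyxy = yxyx\<close> and generate a dihedral group of order 8, which permutes the four
  entries, up to signs, as the symmetries of a square; \<open>z\<close> only changes signs and commutes with
  both.

  That no further relations are needed is a counting argument. Wherever the relations hold,
  multiplying one of the eight alternating products of at most four letters \<open>x\<close> and \<open>y\<close>, with or
  without a letter \<open>z\<close> in front, by a generator from the left gives again one of these sixteen
  (\<open>word_value_normal_form\<close>). Conversely, a single matrix with entries of four different absolute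
  values tells the fifteen nonempty normal forms from the identity (\<open>normal_form_trivial\<close>).
  By \<open>presented_group_iso_generate\<close>, a form of von Dyck's theorem with a criterion for
  injectivity, this makes the presented group isomorphic to the group of operations.

  The argument applies to any set of relations that holds in a group exactly when the dihedral
  and commutation relations do. For involutions, \<open>(ab)\<^sup>2 = 1\<close> says that \<open>a\<close> and \<open>b\<close> commute and
  \<open>(ab)\<^sup>4 = 1\<close> says that \<open>abab = baba\<close>, so it applies to all three presentations.
\<close>

section \<open>The free group\<close>

definition cancels :: "'a \<times> bool \<Rightarrow> 'a \<times> bool \<Rightarrow> bool"
  where "cancels p q \<longleftrightarrow> fst p = fst q \<and> snd p \<noteq> snd q"

definition opposite :: "'a \<times> bool \<Rightarrow> 'a \<times> bool"
  where "opposite p = (fst p, \<not> snd p)"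

abbreviation reduced :: "'a word \<Rightarrow> bool"
  where "reduced \<equiv> successively (\<lambda>p q. \<not> cancels p q)"

lemma reduced_reduced_Cons: "reduced w \<Longrightarrow> reduced (reduced_Cons p w)"
  by (cases w) (auto simp: cancels_def successively_Cons)

lemma reduced_foldr: "reduced v \<Longrightarrow> reduced (foldr reduced_Cons w v)"
  by (induction w) (auto intro: reduced_reduced_Cons)

lemma reduced_reduce: "reduced (reduce w)"
  by (simp add: reduce_def reduced_foldr)

lemma reduce_reduced: "reduced w \<Longrightarrow> reduce w = w"
proof (induction w)
  case (Cons p w)
  then have "reduce w = w"
    by (cases "w = []") (auto simp: successively_Cons reduce_def)
  with Cons.prems show ?case
    by (cases w) (auto simp: reduce_def cancels_def)
qed (simp add: reduce_def)

lemma carrier_free_group: "w \<in> carrier free_group \<longleftrightarrow> reduced w"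
proof
  show "w \<in> carrier free_group" if "reduced w"
    using reduce_reduced[OF that] rangeI[of reduce w] by (simp add: free_group_def)
qed (auto simp: free_group_def reduced_reduce)

text \<open>
  Each letter acts on the reduced words by \<^const>\<open>reduced_Cons\<close>, and opposite letters act by
  inverse permutations. This makes the action of a word depend on its reduction only, from
  which the group laws follow.
\<close>

lemma reduced_Cons_cancel:
  "reduced w \<Longrightarrow> cancels p q \<Longrightarrow> reduced_Cons p (reduced_Cons q w) = w"
  by (cases w; cases "tl w") (auto simp: cancels_def successively_Cons prod_eq_iff)

lemma foldr_reduced_Cons:
  assumes "reduced v"
  shows "foldr reduced_Cons (reduced_Cons p u) v = reduced_Cons p (foldr reduced_Cons u v)"
  using assms reduced_Cons_cancel[OF reduced_foldr[OF assms]]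
  by (cases u) (auto simp: cancels_def)

lemma foldr_reduce:
  "reduced v \<Longrightarrow> foldr reduced_Cons (reduce u) v = foldr reduced_Cons u v"
  by (induction u) (auto simp: reduce_def foldr_reduced_Cons)

lemma reduce_append: "reduce (u @ v) = foldr reduced_Cons u (reduce v)"
  by (simp add: reduce_def)

lemma reduce_append_reduce:
  "reduce (reduce u @ v) = reduce (u @ v)" "reduce (u @ reduce v) = reduce (u @ v)"
  by (simp_all add: reduce_append foldr_reduce reduced_reduce reduce_reduced)

lemma reduce_opposite_cancel: "reduce (map opposite (rev w) @ w) = []"
proof (induction w)
  case (Cons p w)
  have "reduce (map opposite (rev (p # w)) @ p # w)
      = foldr reduced_Cons (map opposite (rev w)) (reduced_Cons (opposite p) (reduced_Cons p (reduce w)))"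
    by (simp add: reduce_def)
  also have "\<dots> = reduce (map opposite (rev w) @ w)"
    using reduced_Cons_cancel[OF reduced_reduce, of "opposite p" p w]
    by (simp add: opposite_def cancels_def reduce_append)
  finally show ?case
    using Cons.IH by simp
qed (simp add: reduce_def)

lemma group_free_group: "group (free_group :: 'a word monoid)"
proof (rule groupI)
  fix u v w :: "'a word"
  show "u \<otimes>\<^bsub>free_group\<^esub> v \<otimes>\<^bsub>free_group\<^esub> w = u \<otimes>\<^bsub>free_group\<^esub> (v \<otimes>\<^bsub>free_group\<^esub> w)"
    by (simp add: free_group_def reduce_append_reduce)
  assume "u \<in> carrier free_group"
  show "\<exists>y\<in>carrier free_group. y \<otimes>\<^bsub>free_group\<^esub> u = \<one>\<^bsub>free_group\<^esub>"
    by (rule bexI[of _ "reduce (map opposite (rev u))"])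
      (simp_all add: free_group_def reduce_append_reduce reduce_opposite_cancel)
next
  show "\<one>\<^bsub>free_group\<^esub> \<in> carrier (free_group :: 'a word monoid)"
    by (simp add: carrier_free_group) (simp add: free_group_def)
  fix u :: "'a word"
  assume "u \<in> carrier free_group"
  then show "\<one>\<^bsub>free_group\<^esub> \<otimes>\<^bsub>free_group\<^esub> u = u"
    by (simp add: carrier_free_group reduce_reduced) (simp add: free_group_def reduce_reduced)
qed (simp add: free_group_def)

interpretation free: group "free_group :: 'a word monoid"
  by (rule group_free_group)

lemma free_gen_closed [simp]: "free_gen a \<in> carrier free_group"
  by (simp add: carrier_free_group free_gen_def)

section \<open>Evaluating words in a group\<close>

definition word_value :: "('g, 'm) monoid_scheme \<Rightarrow> ('a \<Rightarrow> 'g) \<Rightarrow> 'a word \<Rightarrow> 'g"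
  where "word_value G f w =
    foldr (\<lambda>p h. (if snd p then f (fst p) else inv\<^bsub>G\<^esub> f (fst p)) \<otimes>\<^bsub>G\<^esub> h) w \<one>\<^bsub>G\<^esub>"

lemma word_value_Nil [simp]: "word_value G f [] = \<one>\<^bsub>G\<^esub>"
  by (simp add: word_value_def)

lemma word_value_Cons:
  "word_value G f (p # w) =
    (if snd p then f (fst p) else inv\<^bsub>G\<^esub> f (fst p)) \<otimes>\<^bsub>G\<^esub> word_value G f w"
  by (simp add: word_value_def)

definition satisfies ::
    "('g, 'm) monoid_scheme \<Rightarrow> ('a \<Rightarrow> 'g) \<Rightarrow> ('a word \<times> 'a word) set \<Rightarrow> bool"
  where "satisfies G f rels \<longleftrightarrow> (\<forall>(u, v) \<in> rels. word_value G f u = word_value G f v)"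

locale group_family = group G for G (structure) +
  fixes f :: "'b \<Rightarrow> 'a"
  assumes f_closed [simp]: "f i \<in> carrier G"
begin

lemma word_value_closed [simp]: "word_value G f w \<in> carrier G"
  by (induction w) (auto simp: word_value_Cons)

lemma word_value_append: "word_value G f (u @ v) = word_value G f u \<otimes> word_value G f v"
  by (induction u) (auto simp: word_value_Cons m_assoc)

lemma word_value_reduced_Cons: "word_value G f (reduced_Cons p w) = word_value G f (p # w)"
  by (cases w) (auto simp: word_value_Cons m_assoc[symmetric])

lemma word_value_reduce: "word_value G f (reduce w) = word_value G f w"
  by (induction w) (simp_all add: reduce_def word_value_reduced_Cons word_value_Cons)

lemma word_value_free_gen [simp]: "word_value G f (free_gen a) = f a"
  by (simp add: free_gen_def word_value_Cons)

lemma word_value_mult [simp]: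
  "word_value G f (u \<otimes>\<^bsub>free_group\<^esub> v) = word_value G f u \<otimes> word_value G f v"
  by (simp add: free_group_def word_value_reduce word_value_append)

lemma word_value_one [simp]: "word_value G f \<one>\<^bsub>free_group\<^esub> = \<one>"
  by (simp add: free_group_def)

lemma word_value_pow [simp]:
  "word_value G f (u [^]\<^bsub>free_group\<^esub> (n::nat)) = word_value G f u [^] n"
  by (induction n) simp_all

sublocale word_value: group_hom free_group G "word_value G f"
  by unfold_locales (simp add: hom_def)

lemma image_word_value: "word_value G f ` carrier free_group = generate G (range f)"
proof
  have "word_value G f w \<in> generate G (range f)" for w
    by (induction w) (auto simp: word_value_Cons intro: generate.intros)
  then show "word_value G f ` carrier free_group \<subseteq> generate G (range f)"
    by blast
  have "range f \<subseteq> word_value G f ` carrier free_group"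
    using word_value_free_gen free_gen_closed by (metis image_eqI image_subsetI)
  then show "generate G (range f) \<subseteq> word_value G f ` carrier free_group"
    by (rule generate_subgroup_incl) (rule word_value.img_is_subgroup)
qed

end

section \<open>Presented groups\<close>

abbreviation relators :: "('a word \<times> 'a word) set \<Rightarrow> 'a word set"
  where "relators rels \<equiv> {u \<otimes>\<^bsub>free_group\<^esub> inv\<^bsub>free_group\<^esub> v | u v. (u, v) \<in> rels}"

context group
begin

lemma normal_normal_closure:
  assumes "R \<subseteq> carrier G"
  shows "normal_closure G R \<lhd> G"
proof -
  let ?A = "{N. N \<lhd> G \<and> R \<subseteq> N}"
  have "carrier G \<lhd> G"
    by (simp add: normal_inv_iff subgroup_self)
  with assms have "?A \<noteq> {}"
    by blast
  then have "subgroup (\<Inter>?A) G"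
    by (intro subgroups_Inter) (auto simp: normal_imp_subgroup)
  then show ?thesis
    unfolding normal_closure_def by (auto simp: normal_inv_iff)
qed

lemma normal_closure_incl: "R \<subseteq> normal_closure G R"
  by (auto simp: normal_closure_def)

lemma normal_closure_least: "N \<lhd> G \<Longrightarrow> R \<subseteq> N \<Longrightarrow> normal_closure G R \<subseteq> N"
  by (auto simp: normal_closure_def)

end

text \<open>
  The relations that hold for \<open>f\<close> in \<open>G\<close> give a homomorphism of the presented group onto the
  subgroup generated by \<open>f\<close>. For its injectivity, the words in \<open>T\<close> serve as normal forms. That
  they represent all values in a group where the relations hold is applied to the presented
  group itself, where a word evaluates to its own coset. A word with trivial value in \<open>G\<close> is then congruent to a normal form with trivial value in \<open>G\<close>, which is
  empty.
\<close>

theorem presented_group_iso_generate: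
  fixes G (structure) and f :: "'b \<Rightarrow> 'a"
  assumes G: "group_family G f"
    and rels: "rels \<subseteq> carrier free_group \<times> carrier free_group"
    and sat: "satisfies G f rels"
    and T: "T \<subseteq> carrier free_group"
    and normal_form: "\<And>(H :: 'b word set monoid) h w. group_family H h \<Longrightarrow> satisfies H h rels \<Longrightarrow>
      \<exists>n\<in>T. word_value H h w = word_value H h n"
    and trivial: "\<And>n. n \<in> T \<Longrightarrow> word_value G f n = \<one> \<Longrightarrow> n = []"
  shows "presented_group rels \<cong> G\<lparr>carrier := generate G (range f)\<rparr>"
proof -
  interpret G: group_family G f by (rule G)
  define N where "N = normal_closure free_group (relators rels)"
  define P where "P = free_group Mod N"
  define g where "g a = N #>\<^bsub>free_group\<^esub> free_gen a" for a
  have "relators rels \<subseteq> carrier free_group"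
    using rels by auto
  then interpret N: normal N free_group
    unfolding N_def by (rule free.normal_normal_closure)
  interpret P: group_family P g
    unfolding P_def group_family_def group_family_axioms_def
    using N.factorgroup_is_group free_gen_closed by (auto simp: carrier_FactGroup g_def)
  interpret quot: group_hom free_group P "\<lambda>w. N #>\<^bsub>free_group\<^esub> w"
    by unfold_locales (unfold P_def, rule N.r_coset_hom_Mod)
  have letter: "N #>\<^bsub>free_group\<^esub> [p] = (if snd p then g (fst p) else inv\<^bsub>P\<^esub> g (fst p))" for p
  proof (cases p)
    case (Pair a b)
    have "[(a, False)] = inv\<^bsub>free_group\<^esub> free_gen a"
      by (rule free.inv_equality[symmetric])
        (simp_all add: carrier_free_group free_gen_def, simp add: free_group_def reduce_def)
    with Pair show ?thesis
      by (cases b) (simp_all add: g_def quot.hom_inv flip: free_gen_def)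
  qed
  have coset: "word_value P g w = N #>\<^bsub>free_group\<^esub> w" if "reduced w" for w
    using that
  proof (induction w)
    case Nil
    show ?case
      using quot.hom_one by (simp add: free_group_def)
  next
    case (Cons p w)
    then have w: "reduced w"
      by (auto simp: successively_Cons)
    have "p # w = [p] \<otimes>\<^bsub>free_group\<^esub> w"
      using reduce_reduced[OF Cons.prems] by (simp add: free_group_def)
    then have "N #>\<^bsub>free_group\<^esub> (p # w) = (N #>\<^bsub>free_group\<^esub> [p]) \<otimes>\<^bsub>P\<^esub> (N #>\<^bsub>free_group\<^esub> w)"
      using w by (simp add: carrier_free_group)
    with w show ?case
      by (simp add: Cons.IH letter word_value_Cons)
  qed
  have sat_P: "satisfies P g rels"
    unfolding satisfies_def
  proof clarify
    fix u v
    assume uv: "(u, v) \<in> rels"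
    with rels have [simp]: "u \<in> carrier free_group" "v \<in> carrier free_group"
      by auto
    have "u \<otimes>\<^bsub>free_group\<^esub> inv\<^bsub>free_group\<^esub> v \<in> relators rels"
      using uv by blast
    then have "u \<otimes>\<^bsub>free_group\<^esub> inv\<^bsub>free_group\<^esub> v \<in> N"
      unfolding N_def by (rule subsetD[OF free.normal_closure_incl])
    then have "u \<in> N #>\<^bsub>free_group\<^esub> v"
      by (intro N.rcos_module_rev) (simp_all add: group_free_group)
    then have "N #>\<^bsub>free_group\<^esub> u = N #>\<^bsub>free_group\<^esub> v"
      by (intro free.repr_independence[symmetric]) (simp_all add: N.subgroup_axioms)
    then show "word_value P g u = word_value P g v"
      using coset[of u] coset[of v] by (simp add: carrier_free_group[THEN iffD1])
  qed
  have N_kernel: "N \<subseteq> kernel free_group G (word_value G f)"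
    unfolding N_def
  proof (rule free.normal_closure_least[OF G.word_value.normal_kernel], safe)
    fix u v
    assume uv: "(u, v) \<in> rels"
    with rels have "u \<in> carrier free_group" "v \<in> carrier free_group"
      by auto
    moreover have "word_value G f u = word_value G f v"
      using uv sat by (auto simp: satisfies_def)
    ultimately show "u \<otimes>\<^bsub>free_group\<^esub> inv\<^bsub>free_group\<^esub> v \<in> kernel free_group G (word_value G f)"
      by (simp add: kernel_def)
  qed
  moreover have "kernel free_group G (word_value G f) \<subseteq> N"
  proof
    fix w
    assume "w \<in> kernel free_group G (word_value G f)"
    then have w: "w \<in> carrier free_group" "word_value G f w = \<one>"
      by (simp_all add: kernel_def)
    obtain n where n: "n \<in> T" "word_value P g w = word_value P g n"
      using normal_form[OF P.group_family_axioms sat_P] by blast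
    with T have n_closed: "n \<in> carrier free_group"
      by blast
    have "N #>\<^bsub>free_group\<^esub> w = N #>\<^bsub>free_group\<^esub> n"
      using n w n_closed coset[of w] coset[of n] by (simp add: carrier_free_group)
    then have "w \<in> N #>\<^bsub>free_group\<^esub> n"
      using free.rcos_self[OF w(1) N.subgroup_axioms] by simp
    then obtain k where k: "k \<in> N" "w = k \<otimes>\<^bsub>free_group\<^esub> n"
      by (auto simp: r_coset_def)
    then have "word_value G f n = \<one>"
      using N_kernel w(2) by (auto simp: kernel_def)
    then have "n = \<one>\<^bsub>free_group\<^esub>"
      using trivial n(1) by (simp add: free_group_def)
    with k show "w \<in> N"
      using N.subset by auto
  qed
  ultimately have "kernel free_group G (word_value G f) = N"
    by (rule subset_antisym[rotated])
  moreover have "(\<lambda>X. the_elem (word_value G f ` X)) \<in>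
      iso (free_group Mod kernel free_group G (word_value G f)) (G\<lparr>carrier := generate G (range f)\<rparr>)"
  proof -
    let ?H = "G\<lparr>carrier := generate G (range f)\<rparr>"
    have "group ?H"
      by (intro G.subgroup_imp_group G.generate_is_subgroup) auto
    moreover have "word_value G f \<in> hom free_group ?H"
      using G.image_word_value by (auto simp: hom_def)
    ultimately interpret H: group_hom free_group ?H "word_value G f"
      by (simp add: group_hom_def group_hom_axioms_def group_free_group)
    show ?thesis
      using H.FactGroup_iso_set G.image_word_value by (simp add: kernel_def)
  qed
  ultimately show ?thesis
    by (auto simp: is_iso_def presented_group_def N_def)
qed

section \<open>Normal forms in the Coxeter group of type B2 x A1\<close>

text \<open>The products are bracketed to the right because words are evaluated from the right.\<close>

definition B2_A1_relations :: "('g, 'm) monoid_scheme \<Rightarrow> 'g \<Rightarrow> 'g \<Rightarrow> 'g \<Rightarrow> bool"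
  where "B2_A1_relations G x y z \<longleftrightarrow>
    x \<otimes>\<^bsub>G\<^esub> x = \<one>\<^bsub>G\<^esub> \<and> y \<otimes>\<^bsub>G\<^esub> y = \<one>\<^bsub>G\<^esub> \<and> z \<otimes>\<^bsub>G\<^esub> z = \<one>\<^bsub>G\<^esub> \<and>
    x \<otimes>\<^bsub>G\<^esub> (y \<otimes>\<^bsub>G\<^esub> (x \<otimes>\<^bsub>G\<^esub> y)) = y \<otimes>\<^bsub>G\<^esub> (x \<otimes>\<^bsub>G\<^esub> (y \<otimes>\<^bsub>G\<^esub> x)) \<and>
    x \<otimes>\<^bsub>G\<^esub> z = z \<otimes>\<^bsub>G\<^esub> x \<and> y \<otimes>\<^bsub>G\<^esub> z = z \<otimes>\<^bsub>G\<^esub> y"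

definition dihedral_forms :: "3 word set"
  where "dihedral_forms = map (\<lambda>i. (i, True)) `
    {[], [1], [2], [1, 2], [2, 1], [1, 2, 1], [2, 1, 2], [1, 2, 1, 2]}"

definition normal_forms :: "3 word set"
  where "normal_forms = dihedral_forms \<union> Cons (3, True) ` dihedral_forms"

text \<open>
  The values of the normal forms contain \<open>1\<close> and are closed under left multiplication by the
  generators, which are their own inverses. Letters \<open>x\<close> and \<open>y\<close> pass through \<open>z\<close>, so the claim is
  one about alternating products of \<open>x\<close> and \<open>y\<close>: these grow or cancel at the front, and \<open>xyxy = yxyx\<close>
  absorbs the two products that would get too long.
\<close>

lemma word_value_normal_form:
  fixes G (structure) and v :: "3 \<Rightarrow> 'a"
  assumes v: "group_family G v" and rel: "B2_A1_relations G (v 1) (v 2) (v 3)"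
  shows "\<exists>n\<in>normal_forms. word_value G v w = word_value G v n"
proof -
  interpret group_family G v by (rule v)
  define x y z where "x = v 1" and "y = v 2" and "z = v 3"
  have [simp]: "x \<in> carrier G" "y \<in> carrier G" "z \<in> carrier G"
    by (simp_all add: x_def y_def z_def)
  have sq: "x \<otimes> x = \<one>" "y \<otimes> y = \<one>" "z \<otimes> z = \<one>"
    and braid: "x \<otimes> (y \<otimes> (x \<otimes> y)) = y \<otimes> (x \<otimes> (y \<otimes> x))"
    and comm: "x \<otimes> z = z \<otimes> x" "y \<otimes> z = z \<otimes> y"
    using rel by (simp_all add: B2_A1_relations_def x_def y_def z_def)
  have inv: "inv (v i) = v i" for i
    using sq exhaust_3[of i] by (intro inv_equality) (auto simp: x_def y_def z_def)
  have cancel: "x \<otimes> (x \<otimes> a) = a" "y \<otimes> (y \<otimes> a) = a" "z \<otimes> (z \<otimes> a) = a" if "a \<in> carrier G" for a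
    using that sq by (simp_all flip: m_assoc)
  have past_z: "x \<otimes> (z \<otimes> a) = z \<otimes> (x \<otimes> a)" "y \<otimes> (z \<otimes> a) = z \<otimes> (y \<otimes> a)" if "a \<in> carrier G" for a
    using that comm by (simp_all flip: m_assoc)
  \<comment> \<open>With brackets to the right, \<open>yxyx\<close> is not a subterm of \<open>yxyxy\<close>; rewriting \<open>yxyx\<close> to \<open>xyxy\<close> misses it.\<close>
  have turn: "y \<otimes> (x \<otimes> (y \<otimes> (x \<otimes> y))) = x \<otimes> (y \<otimes> x)"
    by (simp add: braid cancel)
  define D where "D = {\<one>, x, y, x \<otimes> y, y \<otimes> x, x \<otimes> (y \<otimes> x), y \<otimes> (x \<otimes> y), x \<otimes> (y \<otimes> (x \<otimes> y))}"
  have D_closed: "d \<in> carrier G" if "d \<in> D" for d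
    using that by (auto simp: D_def)
  have D_mult: "x \<otimes> d \<in> D" "y \<otimes> d \<in> D" if "d \<in> D" for d
    using that unfolding D_def by (auto simp: sq cancel turn braid[symmetric])
  define E where "E = D \<union> (\<otimes>) z ` D"
  have E_mult: "v i \<otimes> e \<in> E" if e: "e \<in> E" for i e
  proof -
    have "x \<otimes> e \<in> E" "y \<otimes> e \<in> E" "z \<otimes> e \<in> E"
      using e D_mult by (auto simp: E_def past_z cancel D_closed)
    then show ?thesis
      using exhaust_3[of i] by (auto simp: x_def y_def z_def)
  qed
  have "word_value G v w \<in> E"
  proof (induction w)
    case Nil
    show ?case
      by (simp add: E_def D_def)
  next
    case (Cons p w)
    then show ?case
      by (simp add: word_value_Cons inv E_mult)
  qed
  moreover have "D = word_value G v ` dihedral_forms"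
    by (simp add: D_def dihedral_forms_def word_value_Cons flip: x_def y_def)
  then have "E = word_value G v ` normal_forms"
    by (simp add: E_def normal_forms_def image_Un image_image word_value_Cons z_def)
  ultimately show ?thesis
    by auto
qed

text \<open>The square of an element is trivial iff the element is its own inverse, and inverting a
  product of involutions reverses it.\<close>

lemma (in group)
  assumes [simp]: "a \<in> carrier G" "b \<in> carrier G" and sq: "a \<otimes> a = \<one>" "b \<otimes> b = \<one>"
  shows pow_2_mult_involutions: "(a \<otimes> b) [^] (2::nat) = \<one> \<longleftrightarrow> a \<otimes> b = b \<otimes> a"
    and pow_4_mult_involutions: "(a \<otimes> b) [^] (4::nat) = \<one> \<longleftrightarrow>
      a \<otimes> (b \<otimes> (a \<otimes> b)) = b \<otimes> (a \<otimes> (b \<otimes> a))"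
proof -
  have [simp]: "inv a = a" "inv b = b"
    using sq by (simp_all add: inv_equality)
  have square: "p \<otimes> p = \<one> \<longleftrightarrow> p = inv p" if "p \<in> carrier G" for p
    using that by (metis inv_equality r_inv)
  show "(a \<otimes> b) [^] (2::nat) = \<one> \<longleftrightarrow> a \<otimes> b = b \<otimes> a"
    using square[of "a \<otimes> b"] by (simp add: numeral_eq_Suc inv_mult_group)
  show "(a \<otimes> b) [^] (4::nat) = \<one> \<longleftrightarrow> a \<otimes> (b \<otimes> (a \<otimes> b)) = b \<otimes> (a \<otimes> (b \<otimes> a))"
    using square[of "a \<otimes> (b \<otimes> (a \<otimes> b))"]
    by (simp add: numeral_eq_Suc inv_mult_group m_assoc)
qed

lemma (in group) B2_A1_relations_iff_powers:
  assumes "x \<in> carrier G" "y \<in> carrier G" "z \<in> carrier G"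
  shows "B2_A1_relations G x y z \<longleftrightarrow>
    x [^] (2::nat) = \<one> \<and> y [^] (2::nat) = \<one> \<and> z [^] (2::nat) = \<one> \<and>
    (x \<otimes> y) [^] (4::nat) = \<one> \<and> (y \<otimes> x) [^] (4::nat) = \<one> \<and>
    (x \<otimes> z) [^] (2::nat) = \<one> \<and> (z \<otimes> x) [^] (2::nat) = \<one> \<and>
    (y \<otimes> z) [^] (2::nat) = \<one> \<and> (z \<otimes> y) [^] (2::nat) = \<one>"
proof -
  have square: "a [^] (2::nat) = a \<otimes> a" if "a \<in> carrier G" for a
    using that by (simp add: numeral_eq_Suc)
  show ?thesis
  proof (cases "x \<otimes> x = \<one> \<and> y \<otimes> y = \<one> \<and> z \<otimes> z = \<one>")
    case True
    with assms show ?thesis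
      unfolding B2_A1_relations_def
      using square[of x] square[of y] square[of z]
        pow_4_mult_involutions[of x y] pow_4_mult_involutions[of y x]
        pow_2_mult_involutions[of x z] pow_2_mult_involutions[of z x]
        pow_2_mult_involutions[of y z] pow_2_mult_involutions[of z y]
      by metis
  next
    case False
    with assms show ?thesis
      unfolding B2_A1_relations_def using square by auto
  qed
qed

section \<open>The group of the elementary operations\<close>

lemma group_bij_op_group: "group (bij_op_group :: ('a \<Rightarrow> 'a) monoid)"
proof (rule groupI)
  fix f :: "'a \<Rightarrow> 'a"
  assume "f \<in> carrier bij_op_group"
  then show "\<exists>g\<in>carrier bij_op_group. g \<otimes>\<^bsub>bij_op_group\<^esub> f = \<one>\<^bsub>bij_op_group\<^esub>"
    by (intro bexI[of _ "inv_into UNIV f"])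
      (auto simp: bij_op_group_def bij_imp_bij_inv surj_iff[THEN iffD1, OF bij_is_surj])
qed (auto simp: bij_op_group_def bij_comp o_assoc)

interpretation bij_op: group "bij_op_group :: ('a \<Rightarrow> 'a) monoid"
  by (rule group_bij_op_group)

definition elementary_gen :: "3 \<Rightarrow> pm22 \<Rightarrow> pm22"
  where "elementary_gen i = (if i = 1 then op_minus else if i = 2 then op_r1 else op_star)"

lemma elementary_gen_simps [simp]:
  "elementary_gen 1 = op_minus" "elementary_gen 2 = op_r1" "elementary_gen 3 = op_star"
  by (simp_all add: elementary_gen_def)

lemma group_family_elementary_gen: "group_family bij_op_group elementary_gen"
  using elementary_operations_bij
  by unfold_locales (auto simp: elementary_gen_def)

lemma op_mat2:
  "op_minus (abs_pm22 (mat2 a b c d)) = abs_pm22 (mat2 d b c a)"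
  "op_r1 (abs_pm22 (mat2 a b c d)) = abs_pm22 (mat2 (- b) a (- d) c)"
  "op_star (abs_pm22 (mat2 a b c d)) = abs_pm22 (mat2 a (- b) (- c) d)"
  by (simp_all add: op_minus.abs_eq op_r1.abs_eq op_star.abs_eq)

lemma B2_A1_relations_elementary:
  "B2_A1_relations bij_op_group op_minus op_r1 op_star"
  unfolding B2_A1_relations_def bij_op_group_def
  by (simp add: fun_eq_iff, intro conjI allI; transfer; simp add: mat2_eq_iff)

text \<open>
  The images of the matrix with entries 1, 2, 3, 4 are compared up to sign. The dihedral part
  of a normal form is determined by the positions of the absolute values, and the letter for
  \<open>*\<close> by the relative signs.
\<close>

lemma normal_form_trivial:
  assumes "n \<in> normal_forms"
    and "word_value bij_op_group elementary_gen n = \<one>\<^bsub>bij_op_group\<^esub>"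
  shows "n = []"
proof -
  have "word_value bij_op_group elementary_gen n (abs_pm22 (mat2 1 2 3 4)) = abs_pm22 (mat2 1 2 3 4)"
    using assms(2) by (simp add: bij_op_group_def)
  with assms(1) show ?thesis
    by (auto simp: normal_forms_def dihedral_forms_def word_value_Cons bij_op_group_def op_mat2
        pm22.abs_eq_iff mat2_eq_iff)
qed

lemma GF_eq_generate:
  "GF = bij_op_group\<lparr>carrier := generate bij_op_group (range elementary_gen)\<rparr>"
proof -
  let ?S = "{op_star, op_minus, op_r1, op_r2, op_R}" and ?T = "range elementary_gen"
  have T: "?T = {op_minus, op_r1, op_star}"
    using exhaust_3 by (auto simp: elementary_gen_def image_iff) (metis elementary_gen_simps)+
  then have sub: "subgroup (generate bij_op_group ?T) bij_op_group"
    using elementary_operations_bij by (intro bij_op.generate_is_subgroup) auto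
  note mult = subgroup.m_closed[OF sub]
  have gen: "op_minus \<in> generate bij_op_group ?T" "op_r1 \<in> generate bij_op_group ?T"
    "op_star \<in> generate bij_op_group ?T"
    by (auto simp: T intro: generate.incl)
  have r2: "op_r2 = op_minus \<otimes>\<^bsub>bij_op_group\<^esub> (op_r1 \<otimes>\<^bsub>bij_op_group\<^esub> op_minus)"
    by (simp add: bij_op_group_def fun_eq_iff, intro allI, transfer, simp add: mat2_eq_iff)
  have R: "op_R = op_r1 \<otimes>\<^bsub>bij_op_group\<^esub> op_r2"
    by (simp add: bij_op_group_def fun_eq_iff, intro allI, transfer, simp add: mat2_eq_iff)
  have r2_gen: "op_r2 \<in> generate bij_op_group ?T"
    unfolding r2 by (intro mult gen)
  then have "op_R \<in> generate bij_op_group ?T"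
    unfolding R by (intro mult gen)
  with gen r2_gen have "generate bij_op_group ?S \<subseteq> generate bij_op_group ?T"
    by (intro bij_op.generate_subgroup_incl[OF _ sub]) simp
  moreover have "generate bij_op_group ?T \<subseteq> generate bij_op_group ?S"
    by (intro bij_op.mono_generate) (auto simp: T)
  ultimately show ?thesis
    by (simp add: GF_def)
qed

text \<open>
  This is where the three presentations meet: from each set of relations, only enough is
  extracted to bring words to normal form.
\<close>

lemma GF_iso_presented_group:
  assumes rels: "rels \<subseteq> carrier free_group \<times> carrier free_group"
    and sat: "satisfies bij_op_group elementary_gen rels"
    and imp: "\<And>(H :: 3 word set monoid) h. group_family H h \<Longrightarrow> satisfies H h rels \<Longrightarrow>
      B2_A1_relations H (h 1) (h 2) (h 3)"
  shows "GF \<cong> presented_group rels"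
proof -
  interpret group_family bij_op_group elementary_gen
    by (rule group_family_elementary_gen)
  have "presented_group rels \<cong> GF"
    unfolding GF_eq_generate
  proof (rule presented_group_iso_generate[where T = normal_forms])
    show "normal_forms \<subseteq> carrier free_group"
      by (auto simp: normal_forms_def dihedral_forms_def carrier_free_group cancels_def)
    show "\<exists>n\<in>normal_forms. word_value H h w = word_value H h n"
      if "group_family H h" "satisfies H h rels" for H :: "3 word set monoid" and h w
      using that by (intro word_value_normal_form imp)
  qed (use group_family_elementary_gen rels sat normal_form_trivial in auto)
  moreover have "group (presented_group rels)"
    unfolding presented_group_def
    using rels by (intro normal.factorgroup_is_group free.normal_normal_closure) auto
  ultimately show ?thesis
    by (rule group.iso_sym[rotated])
qed

section \<open>The three presentations\<close>

definition braid_relations :: "(3 word \<times> 3 word) set"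
  where "braid_relations = {
    (free_gen 1 [^]\<^bsub>free_group\<^esub> (2::nat), \<one>\<^bsub>free_group\<^esub>),
    (free_gen 2 [^]\<^bsub>free_group\<^esub> (2::nat), \<one>\<^bsub>free_group\<^esub>),
    (free_gen 3 [^]\<^bsub>free_group\<^esub> (2::nat), \<one>\<^bsub>free_group\<^esub>),
    (free_gen 1 \<otimes>\<^bsub>free_group\<^esub> free_gen 2 \<otimes>\<^bsub>free_group\<^esub> free_gen 1 \<otimes>\<^bsub>free_group\<^esub> free_gen 2,
      free_gen 2 \<otimes>\<^bsub>free_group\<^esub> free_gen 1 \<otimes>\<^bsub>free_group\<^esub> free_gen 2 \<otimes>\<^bsub>free_group\<^esub> free_gen 1),
    (free_gen 1 \<otimes>\<^bsub>free_group\<^esub> free_gen 3, free_gen 3 \<otimes>\<^bsub>free_group\<^esub> free_gen 1),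
    (free_gen 2 \<otimes>\<^bsub>free_group\<^esub> free_gen 3, free_gen 3 \<otimes>\<^bsub>free_group\<^esub> free_gen 2)}"

definition power_relations :: "(3 word \<times> 3 word) set"
  where "power_relations = {
    (free_gen 1 [^]\<^bsub>free_group\<^esub> (2::nat), \<one>\<^bsub>free_group\<^esub>),
    (free_gen 2 [^]\<^bsub>free_group\<^esub> (2::nat), \<one>\<^bsub>free_group\<^esub>),
    (free_gen 3 [^]\<^bsub>free_group\<^esub> (2::nat), \<one>\<^bsub>free_group\<^esub>),
    ((free_gen 1 \<otimes>\<^bsub>free_group\<^esub> free_gen 2) [^]\<^bsub>free_group\<^esub> (4::nat), \<one>\<^bsub>free_group\<^esub>),
    ((free_gen 2 \<otimes>\<^bsub>free_group\<^esub> free_gen 1) [^]\<^bsub>free_group\<^esub> (4::nat), \<one>\<^bsub>free_group\<^esub>),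
    ((free_gen 1 \<otimes>\<^bsub>free_group\<^esub> free_gen 3) [^]\<^bsub>free_group\<^esub> (2::nat), \<one>\<^bsub>free_group\<^esub>),
    ((free_gen 3 \<otimes>\<^bsub>free_group\<^esub> free_gen 1) [^]\<^bsub>free_group\<^esub> (2::nat), \<one>\<^bsub>free_group\<^esub>),
    ((free_gen 2 \<otimes>\<^bsub>free_group\<^esub> free_gen 3) [^]\<^bsub>free_group\<^esub> (2::nat), \<one>\<^bsub>free_group\<^esub>),
    ((free_gen 3 \<otimes>\<^bsub>free_group\<^esub> free_gen 2) [^]\<^bsub>free_group\<^esub> (2::nat), \<one>\<^bsub>free_group\<^esub>)}"

definition coxeter_relations :: "nat^'n^'n \<Rightarrow> ('n word \<times> 'n word) set"
  where "coxeter_relations M =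
    {((free_gen i \<otimes>\<^bsub>free_group\<^esub> free_gen j) [^]\<^bsub>free_group\<^esub> (M $ i $ j), \<one>\<^bsub>free_group\<^esub>) | i j. True}"

lemma satisfies_braid_relations:
  assumes "group_family G f"
  shows "satisfies G f braid_relations \<longleftrightarrow> B2_A1_relations G (f 1) (f 2) (f 3)"
proof -
  interpret group_family G f by (rule assms)
  show ?thesis
    by (simp add: satisfies_def braid_relations_def B2_A1_relations_def numeral_eq_Suc m_assoc)
qed

lemma satisfies_power_relations:
  assumes "group_family G f"
  shows "satisfies G f power_relations \<longleftrightarrow> B2_A1_relations G (f 1) (f 2) (f 3)"
proof -
  interpret group_family G f by (rule assms)
  show ?thesis
    by (simp add: satisfies_def power_relations_def B2_A1_relations_iff_powers)
qed

text \<open>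
  The diagonal entries of the Coxeter matrix give the exponent 1 of \<open>x\<^sub>i x\<^sub>i\<close>, that is, the
  relations \<open>x\<^sub>i\<^sup>2 = 1\<close>; the others are literally the remaining power relations.
\<close>

lemma satisfies_coxeter_relations:
  fixes f :: "3 \<Rightarrow> 'g"
  assumes "group_family G f"
  shows "satisfies G f (coxeter_relations (vector [vector [1, 4, 2], vector [4, 1, 2], vector [2, 2, 1]]))
    \<longleftrightarrow> B2_A1_relations G (f 1) (f 2) (f 3)"
proof -
  interpret group_family G f by (rule assms)
  have "satisfies G f (coxeter_relations M) \<longleftrightarrow> 
      (\<forall>i j. (f i \<otimes>\<^bsub>G\<^esub> f j) [^]\<^bsub>G\<^esub> (M $ i $ j) = \<one>\<^bsub>G\<^esub>)" for M :: "nat^3^3"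
    by (force simp: satisfies_def coxeter_relations_def)
  moreover have "a [^]\<^bsub>G\<^esub> (2::nat) = a \<otimes>\<^bsub>G\<^esub> a" if "a \<in> carrier G" for a
    using that by (simp add: numeral_eq_Suc)
  ultimately show ?thesis
    by (auto simp: forall_3 B2_A1_relations_iff_powers)
qed

theorem theorem4p6:
  fixes F :: "3 word monoid" (structure)
    and x y z :: "3 word"
    and M :: "nat^3^3"
  defines "F \<equiv> free_group"
    and "x \<equiv> free_gen 1" and "y \<equiv> free_gen 2" and "z \<equiv> free_gen 3"
    and "M \<equiv> vector [vector [1, 4, 2], vector [4, 1, 2], vector [2, 2, 1]]"
  shows "GF \<cong> presented_group
      {(x [^] (2::nat), \<one>), (y [^] (2::nat), \<one>), (z [^] (2::nat), \<one>),
       (x \<otimes> y \<otimes> x \<otimes> y, y \<otimes> x \<otimes> y \<otimes> x), (x \<otimes> z, z \<otimes> x), (y \<otimes> z, z \<otimes> y)}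
    \<and> coxeter_matrix M \<and> GF \<cong> coxeter_group M
    \<and> GF \<cong> presented_group
      {(x [^] (2::nat), \<one>), (y [^] (2::nat), \<one>), (z [^] (2::nat), \<one>),
       ((x \<otimes> y) [^] (4::nat), \<one>), ((y \<otimes> x) [^] (4::nat), \<one>),
       ((x \<otimes> z) [^] (2::nat), \<one>), ((z \<otimes> x) [^] (2::nat), \<one>),
       ((y \<otimes> z) [^] (2::nat), \<one>), ((z \<otimes> y) [^] (2::nat), \<one>)}"
proof (intro conjI)
  note gen = group_family_elementary_gen and rel = B2_A1_relations_elementary
  have "GF \<cong> presented_group braid_relations"
    by (intro GF_iso_presented_group)
      (simp_all add: satisfies_braid_relations gen rel,
        auto simp: braid_relations_def)
  then show "GF \<cong> presented_group
      {(x [^] (2::nat), \<one>), (y [^] (2::nat), \<one>), (z [^] (2::nat), \<one>),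
       (x \<otimes> y \<otimes> x \<otimes> y, y \<otimes> x \<otimes> y \<otimes> x), (x \<otimes> z, z \<otimes> x), (y \<otimes> z, z \<otimes> y)}"
    by (simp only: braid_relations_def F_def x_def y_def z_def)
  have "GF \<cong> presented_group power_relations"
    by (intro GF_iso_presented_group)
      (simp_all add: satisfies_power_relations gen rel,
        auto simp: power_relations_def)
  then show "GF \<cong> presented_group
      {(x [^] (2::nat), \<one>), (y [^] (2::nat), \<one>), (z [^] (2::nat), \<one>),
       ((x \<otimes> y) [^] (4::nat), \<one>), ((y \<otimes> x) [^] (4::nat), \<one>),
       ((x \<otimes> z) [^] (2::nat), \<one>), ((z \<otimes> x) [^] (2::nat), \<one>),
       ((y \<otimes> z) [^] (2::nat), \<one>), ((z \<otimes> y) [^] (2::nat), \<one>)}"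
    by (simp only: power_relations_def F_def x_def y_def z_def)
  show "coxeter_matrix M"
    by (simp add: coxeter_matrix_def M_def forall_3)
  have "GF \<cong> presented_group (coxeter_relations M)"
    by (intro GF_iso_presented_group)
      (simp_all add: satisfies_coxeter_relations[folded M_def] gen rel,
        auto simp: coxeter_relations_def)
  then show "GF \<cong> coxeter_group M"
    by (simp add: coxeter_group_def coxeter_relations_def)
qed

end
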